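(* Let $\Delta\subseteq S^3$ be a spherical tetrahedron with vertices $v_0,v_1,v_2,v_3$. Let $\{i,j,k,m\}=\{0,1,2,3\}$, let $\theta=\theta_{ij}$ be the interior dihedral angle of $\Delta$ at the edge $v_iv_j$, and let $l'=l_{km}$ be the length of the opposite edge $v_kv_m$. Then the Wigner derivative and the inverse Wigner derivative are equal: $$\frac{\partial \theta(l_{01},l_{02},l_{03},l_{12},l_{13},l_{23})}{\partial l'}=\frac{\partial l'(\theta_{01},\theta_{02},\theta_{03},\theta_{12},\theta_{13},\theta_{23})}{\partial \theta},$$ where on the left $\theta$ is regarded as a function of the six edge lengths and the five edge lengths other than $l'$ are held fixed, and on the right $l'$ is regarded as a function of the six interior dihedral angles and the five dihedral angles other than $\theta$ are held fixed; both derivatives are evaluated at the same tetrahedron $\Delta$.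
   Context: Given linearly independent unit vectors $v_0,v_1,v_2,v_3\in S^3\subset\mathbb{R}^4$, the spherical tetrahedron with these vertices is $\Delta=\{t_0v_0+t_1v_1+t_2v_2+t_3v_3 : t_0,\dots,t_3\ge 0\}\cap S^3$. The edge length $l_{pq}=l(v_p,v_q)\in(0,\pi)$ is the spherical distance between $v_p$ and $v_q$, i.e. $\cos l_{pq}=v_p\cdot v_q$. The interior dihedral angle $\theta_{ij}\in(0,\pi)$ at the edge $v_iv_j$ is the angle with $\cos\theta_{ij}=-w_k\cdot w_m$, where $\{i,j,k,m\}=\{0,1,2,3\}$ and, for each $p$, $w_p\in\mathbb{R}^4$ is the outward unit normal to the face of $\Delta$ opposite $v_p$ (so $w_p\cdot v_q=0$ for $q\neq p$ and $w_p\cdot v_p<0$). A spherical tetrahedron is determined up to isometry by its six edge lengths, and also by its six interior dihedral angles, so there is a one-to-one correspondence between the 6-tuples of edge lengths and the 6-tuples of interior dihedral angles of spherical tetrahedra. It is via this correspondence that dihedral angles are regarded as functions of the six edge lengths and edge lengths as functions of the six dihedral angles. *)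

theory Defs
  imports "HOL-Analysis.Analysis"
begin

text \<open>A spherical tetrahedron in the unit sphere of \<open>\<real>\<^sup>4\<close> is given by its labelled vertices;
  the index type \<open>4\<close> has exactly the elements 0, 1, 2, 3.\<close>

definition spherical_tetrahedron :: "(4 \<Rightarrow> real ^ 4) \<Rightarrow> bool" where
  "spherical_tetrahedron v \<longleftrightarrow> (\<forall>p. norm (v p) = 1) \<and> inj v \<and> independent (range v)"

definition edge_length :: "(4 \<Rightarrow> real ^ 4) \<Rightarrow> 4 \<Rightarrow> 4 \<Rightarrow> real" where
  "edge_length v p q = arccos (v p \<bullet> v q)"

definition outward_normal :: "(4 \<Rightarrow> real ^ 4) \<Rightarrow> 4 \<Rightarrow> real ^ 4" where
  "outward_normal v p =
     (THE w. norm w = 1 \<and> (\<forall>q. q \<noteq> p \<longrightarrow> w \<bullet> v q = 0) \<and> w \<bullet> v p < 0)"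

definition dihedral_angle :: "(4 \<Rightarrow> real ^ 4) \<Rightarrow> 4 \<Rightarrow> 4 \<Rightarrow> real" where
  "dihedral_angle v i j =
     (THE \<theta>. 0 < \<theta> \<and> \<theta> < pi \<and>
        (\<forall>k m. {i, j, k, m} = {0, 1, 2, 3} \<longrightarrow>
           cos \<theta> = - (outward_normal v k \<bullet> outward_normal v m)))"

text \<open>A 6-tuple indexed by the edges is a function \<open>4 \<Rightarrow> 4 \<Rightarrow> real\<close> of which only the
  off-diagonal values matter. The following two functions are the two directions of the
  correspondence between edge lengths and dihedral angles; their values are unspecified at
  tuples that are not realized by any tetrahedron.\<close>

definition angle_of_lengths :: "4 \<Rightarrow> 4 \<Rightarrow> (4 \<Rightarrow> 4 \<Rightarrow> real) \<Rightarrow> real" where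
  "angle_of_lengths i j l =
     (THE \<theta>. \<exists>v. spherical_tetrahedron v \<and>
        (\<forall>p q. p \<noteq> q \<longrightarrow> edge_length v p q = l p q) \<and> dihedral_angle v i j = \<theta>)"

definition length_of_angles :: "4 \<Rightarrow> 4 \<Rightarrow> (4 \<Rightarrow> 4 \<Rightarrow> real) \<Rightarrow> real" where
  "length_of_angles k m a =
     (THE l. \<exists>v. spherical_tetrahedron v \<and>
        (\<forall>p q. p \<noteq> q \<longrightarrow> dihedral_angle v p q = a p q) \<and> edge_length v k m = l)"

text \<open>Both orderings of an edge carry the same value, so both are changed.\<close>

definition edge_upd :: "(4 \<Rightarrow> 4 \<Rightarrow> real) \<Rightarrow> 4 \<Rightarrow> 4 \<Rightarrow> real \<Rightarrow> (4 \<Rightarrow> 4 \<Rightarrow> real)" where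
  "edge_upd f p q t = (\<lambda>r s. if {r, s} = {p, q} then t else f r s)"

end

theory Submission
  imports Defs
begin

text \<open>Write \<open>w p\<close> for the outward normal of the face opposite \<open>v p\<close>. Both derivatives are equal to
  \<open>sin l' * sin \<theta> / ((w k \<bullet> v k) * (w m \<bullet> v m))\<close>.

  For the first one, project along the edge \<open>v i, v j\<close>. The components \<open>x\<close> and \<open>y\<close> of \<open>v k\<close> and
  \<open>v m\<close> orthogonal to the edge include the angle \<open>\<theta>\<close> (\<open>dihedral_sector\<close>), so
  \<open>cos l' = A + norm x * norm y * cos \<theta>\<close>, where \<open>A\<close>, \<open>norm x\<close> and \<open>norm y\<close> depend on the five
  other lengths only. Conversely, rotating \<open>v m\<close> about the edge realizes every \<open>\<theta>\<close> in \<open>(0, \<pi>)\<close>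
  without changing those five lengths (\<open>rotated_tetrahedron\<close>). Hence near the given tetrahedron
  \<open>\<theta>\<close> is a well-defined function of \<open>l'\<close> (\<open>realizable_angle_iff\<close>), with derivative
  \<open>sin l' / (norm x * norm y * sin \<theta>)\<close>. The formula above follows from
  \<open>w k \<bullet> v k = - norm x * sin \<theta>\<close> and its analogue for \<open>m\<close>.

  The second derivative is the first one for the polar tetrahedron, whose vertices are the \<open>w p\<close> and
  whose normals are the \<open>v p\<close> (\<open>polar_polar\<close>). Passing to the polar replaces lengths and dihedral
  angles by the supplements of the angles and lengths at the opposite edges
  (\<open>dihedral_angle_eq_polar_length\<close>). So it turns the problem of recovering lengths from angles into
  that of recovering angles from lengths, and it exchanges \<open>sin l'\<close> with \<open>sin \<theta>\<close> and vertices
  with normals, which leaves the formula unchanged.\<close>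

section \<open>Labellings of the vertices\<close>

lemma zero_to_three_eq_UNIV: "{0, 1, 2, 3} = (UNIV :: 4 set)"
proof -
  have "(4 :: 4) = 0" by simp
  then have "x \<in> {0, 1, 2, 3}" for x :: 4 using exhaust_4[of x] by (elim disjE) simp_all
  then show ?thesis by blast
qed

lemma labelling_distinct:
  assumes "{i, j, k, m} = (UNIV :: 4 set)"
  shows "i \<noteq> j" "i \<noteq> k" "i \<noteq> m" "j \<noteq> k" "j \<noteq> m" "k \<noteq> m"
proof -
  have "card {i, j, k, m} = 4" using assms by simp
  then show "i \<noteq> j" "i \<noteq> k" "i \<noteq> m" "j \<noteq> k" "j \<noteq> m" "k \<noteq> m"
    by (auto simp: card_insert_if split: if_splits)
qed

lemma labelling_exhaust:
  assumes "{i, j, k, m} = (UNIV :: 4 set)"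
  shows "q = i \<or> q = j \<or> q = k \<or> q = m"
  using assms by (metis UNIV_I empty_iff insert_iff)

lemma labelling_opposite_edge_unique:
  assumes "{i, j, k, m} = (UNIV :: 4 set)" "{i, j, k', m'} = (UNIV :: 4 set)"
  shows "{k', m'} = {k, m}"
proof -
  have "{k, m} = UNIV - {i, j}"
    using labelling_distinct[OF assms(1)] assms(1) by auto
  moreover have "{k', m'} = UNIV - {i, j}"
    using labelling_distinct[OF assms(2)] assms(2) by auto
  ultimately show ?thesis by simp
qed

lemma labelling_complete:
  assumes "p \<noteq> (q :: 4)"
  obtains r s where "{p, q, r, s} = (UNIV :: 4 set)"
proof -
  have "card (UNIV - {p, q}) = 2"
    using assms by (subst card_Diff_subset) auto
  then obtain r s where "UNIV - {p, q} = {r, s}"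
    by (auto simp: card_2_iff)
  then have "{p, q, r, s} = UNIV" by auto
  then show ?thesis by (rule that)
qed

section \<open>Outward normals and the polar tetrahedron\<close>

lemma tetrahedron_norm: "spherical_tetrahedron v \<Longrightarrow> norm (v p) = 1"
  by (simp add: spherical_tetrahedron_def)

lemma tetrahedron_inner_self: "spherical_tetrahedron v \<Longrightarrow> v p \<bullet> v p = 1"
  by (simp add: tetrahedron_norm dot_square_norm)

lemma orthogonal_to_tetrahedron_imp_zero:
  assumes "spherical_tetrahedron v" "\<And>q. x \<bullet> v q = 0"
  shows "x = 0"
proof -
  have "independent (range v)" "card (range v) = 4"
    using assms(1) by (auto simp: spherical_tetrahedron_def card_image)
  then have "UNIV \<subseteq> span (range v)"
    by (intro card_ge_dim_independent) auto
  then have "orthogonal x x"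
    by (intro orthogonal_to_span[of x "range v"]) (auto simp: orthogonal_def assms(2))
  then show ?thesis by (simp add: orthogonal_def)
qed

text \<open>The two candidates are positively proportional: a suitable difference \<open>w - c * w'\<close> is
  orthogonal to \<open>v p\<close> too, hence to all four vertices, and so vanishes.\<close>

lemma tetrahedron_normal_unique:
  assumes "spherical_tetrahedron v"
    and w: "norm w = 1" "\<And>q. q \<noteq> p \<Longrightarrow> w \<bullet> v q = 0" "w \<bullet> v p < 0"
    and w': "norm w' = 1" "\<And>q. q \<noteq> p \<Longrightarrow> w' \<bullet> v q = 0" "w' \<bullet> v p < 0"
  shows "w = w'"
proof -
  define c where "c = (w \<bullet> v p) / (w' \<bullet> v p)"
  have "c > 0" using w(3) w'(3) by (simp add: c_def divide_neg_neg)
  have "(w - c *\<^sub>R w') \<bullet> v q = 0" for q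
    using w w' by (cases "q = p") (auto simp: c_def inner_diff_left)
  then have "w = c *\<^sub>R w'"
    using orthogonal_to_tetrahedron_imp_zero[OF assms(1)] by (metis right_minus_eq)
  moreover from this have "c = 1" using w(1) w'(1) \<open>c > 0\<close> by simp
  ultimately show ?thesis by simp
qed

text \<open>The normal is minus the normalized component of \<open>v p\<close> orthogonal to the other vertices.\<close>

lemma tetrahedron_normal_exists:
  assumes "spherical_tetrahedron v"
  shows "\<exists>w. norm w = 1 \<and> (\<forall>q. q \<noteq> p \<longrightarrow> w \<bullet> v q = 0) \<and> w \<bullet> v p < 0"
proof -
  obtain y z where y: "y \<in> span (v ` (- {p}))"
    and z: "\<And>x. x \<in> span (v ` (- {p})) \<Longrightarrow> orthogonal z x" and yz: "v p = y + z"
    using orthogonal_subspace_decomp_exists[of "v ` (- {p})" "v p"] by blast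
  have "v p \<notin> span (v ` (- {p}))"
  proof -
    have "range v - {v p} = v ` (- {p})"
      using assms by (auto simp: spherical_tetrahedron_def inj_def)
    then show ?thesis
      using assms unfolding spherical_tetrahedron_def dependent_def by (metis rangeI)
  qed
  then have "z \<noteq> 0" using y yz by auto
  have "z \<bullet> v p = z \<bullet> z" using z[OF y] by (simp add: yz inner_add_right orthogonal_def)
  moreover have "z \<bullet> z > 0" using \<open>z \<noteq> 0\<close> by simp
  moreover have "z \<bullet> v q = 0" if "q \<noteq> p" for q
    using z[of "v q"] that by (simp add: orthogonal_def span_base)
  ultimately show ?thesis
    using \<open>z \<noteq> 0\<close> by (intro exI[of _ "- (z /\<^sub>R norm z)"]) auto
qed

lemma outward_normal_properties:
  assumes "spherical_tetrahedron v"
  shows norm_outward_normal: "norm (outward_normal v p) = 1"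
    and outward_normal_orthogonal: "q \<noteq> p \<Longrightarrow> outward_normal v p \<bullet> v q = 0"
    and outward_normal_negative: "outward_normal v p \<bullet> v p < 0"
proof -
  have "\<exists>!w. norm w = 1 \<and> (\<forall>q. q \<noteq> p \<longrightarrow> w \<bullet> v q = 0) \<and> w \<bullet> v p < 0"
    using tetrahedron_normal_exists[OF assms, of p]
    by (elim ex_ex1I) (blast intro: tetrahedron_normal_unique[OF assms])
  from theI'[OF this]
  show "norm (outward_normal v p) = 1" "q \<noteq> p \<Longrightarrow> outward_normal v p \<bullet> v q = 0"
    "outward_normal v p \<bullet> v p < 0"
    unfolding outward_normal_def by auto
qed

lemma outward_normal_eqI:
  assumes "spherical_tetrahedron v"
    and "norm w = 1" "\<And>q. q \<noteq> p \<Longrightarrow> w \<bullet> v q = 0" "w \<bullet> v p < 0"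
  shows "outward_normal v p = w"
  using tetrahedron_normal_unique[OF assms(1)] outward_normal_properties[OF assms(1)] assms
  by metis

text \<open>A biorthogonal family certifies linear independence: a vector that is orthogonal to all
  vertices but one separates that vertex from the span of the others.\<close>

lemma spherical_tetrahedronI_biorthogonal:
  assumes "\<And>p. norm (v p) = 1"
    and orth: "\<And>p q. q \<noteq> p \<Longrightarrow> w p \<bullet> v q = 0" and nz: "\<And>p. w p \<bullet> v p \<noteq> 0"
  shows "spherical_tetrahedron v"
  unfolding spherical_tetrahedron_def
proof (intro conjI allI)
  show "inj v" using orth nz by (metis injI)
  show "independent (range v)"
    unfolding dependent_def
  proof clarify
    fix p assume "v p \<in> span (range v - {v p})"
    then have "orthogonal (w p) (v p)"
      by (rule orthogonal_to_span) (auto simp: orthogonal_def intro!: orth)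
    then show False using nz by (simp add: orthogonal_def)
  qed
qed (rule assms(1))

text \<open>The conditions that define the outward normals are symmetric in vertices and normals. So
  the normals are the vertices of a tetrahedron, the polar of the given one, and its normals are
  the original vertices.\<close>

lemma polar_tetrahedron:
  assumes "spherical_tetrahedron v"
  shows "spherical_tetrahedron (outward_normal v)"
proof (rule spherical_tetrahedronI_biorthogonal[where w = v])
  show "v p \<bullet> outward_normal v q = 0" if "q \<noteq> p" for p q
    using outward_normal_orthogonal[OF assms, of p q] that by (simp add: inner_commute)
  show "v p \<bullet> outward_normal v p \<noteq> 0" for p
    using outward_normal_negative[OF assms, of p] by (simp add: inner_commute)
qed (rule norm_outward_normal[OF assms])

lemma polar_polar:
  assumes "spherical_tetrahedron v"
  shows "outward_normal (outward_normal v) = v"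
proof
  fix p
  show "outward_normal (outward_normal v) p = v p"
  proof (rule outward_normal_eqI[OF polar_tetrahedron[OF assms]])
    show "v p \<bullet> outward_normal v q = 0" if "q \<noteq> p" for q
      using outward_normal_orthogonal[OF assms, of p q] that by (simp add: inner_commute)
    show "v p \<bullet> outward_normal v p < 0"
      using outward_normal_negative[OF assms, of p] by (simp add: inner_commute)
  qed (rule tetrahedron_norm[OF assms])
qed

lemma tetrahedron_inner_bounds:
  assumes "spherical_tetrahedron v" "p \<noteq> q"
  shows "(v p \<bullet> v q)\<^sup>2 < 1" "\<bar>v p \<bullet> v q\<bar> < 1"
proof -
  define c where "c = v p \<bullet> v q"
  define u where "u = v p - c *\<^sub>R v q"
  have "outward_normal v p \<bullet> u = outward_normal v p \<bullet> v p"
    using outward_normal_orthogonal[OF assms(1), of q p] assms(2)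
    by (simp add: u_def inner_diff_right)
  then have "u \<noteq> 0" using outward_normal_negative[OF assms(1), of p] by auto
  then have "u \<bullet> u > 0" by simp
  also have "u \<bullet> u = 1 - c\<^sup>2"
    using tetrahedron_inner_self[OF assms(1)]
    by (simp add: u_def c_def inner_diff_left inner_diff_right inner_commute power2_eq_square)
  finally show *: "(v p \<bullet> v q)\<^sup>2 < 1" by (simp add: c_def)
  then show "\<bar>v p \<bullet> v q\<bar> < 1" by (simp add: abs_square_less_1)
qed

lemma edge_length_bounds:
  assumes "spherical_tetrahedron v" "p \<noteq> q"
  shows "0 < edge_length v p q" "edge_length v p q < pi" "cos (edge_length v p q) = v p \<bullet> v q"
  using tetrahedron_inner_bounds[OF assms] arccos_lt_bounded[of "v p \<bullet> v q"]
  by (auto simp: edge_length_def cos_arccos_abs)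

text \<open>Angles of a tetrahedron and lengths of its polar are supplementary at opposite edges,
  because both are read off from the same two normals.\<close>

lemma dihedral_angle_eq_polar_length:
  assumes "spherical_tetrahedron v" "{i, j, k, m} = UNIV"
  shows "dihedral_angle v i j = pi - edge_length (outward_normal v) k m"
proof -
  let ?w = "outward_normal v"
  note ed = edge_length_bounds[OF polar_tetrahedron[OF assms(1)] labelling_distinct(6)[OF assms(2)]]
  have "?w k' \<bullet> ?w m' = ?w k \<bullet> ?w m" if "{i, j, k', m'} = UNIV" for k' m'
    using labelling_opposite_edge_unique[OF assms(2) that]
    by (auto simp: doubleton_eq_iff inner_commute)
  then have all: "(\<forall>k m. {i, j, k, m} = {0, 1, 2, 3} \<longrightarrow> P (- (?w k \<bullet> ?w m)))
      \<longleftrightarrow> P (- (?w k \<bullet> ?w m))" for P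
    unfolding zero_to_three_eq_UNIV using assms(2) by metis
  show ?thesis
    unfolding dihedral_angle_def all[where P = "\<lambda>x. cos _ = x"]
  proof (rule the_equality)
    fix t assume t: "0 < t \<and> t < pi \<and> cos t = - (?w k \<bullet> ?w m)"
    have "cos (pi - t) = cos (edge_length ?w k m)" using t ed by simp
    then have "pi - t = edge_length ?w k m"
      using t ed cos_inj_pi[of "pi - t" "edge_length ?w k m"] by simp
    then show "t = pi - edge_length ?w k m" by simp
  qed (use ed in auto)
qed

lemma edge_length_eq_polar_angle:
  assumes "spherical_tetrahedron v" "{i, j, k, m} = UNIV"
  shows "edge_length v k m = pi - dihedral_angle (outward_normal v) i j"
  using dihedral_angle_eq_polar_length[OF polar_tetrahedron[OF assms(1)] assms(2)]
  by (simp add: polar_polar[OF assms(1)])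

lemma dihedral_angle_bounds:
  assumes "spherical_tetrahedron v" "{i, j, k, m} = UNIV"
  shows "0 < dihedral_angle v i j" "dihedral_angle v i j < pi"
    and "cos (dihedral_angle v i j) = - (outward_normal v k \<bullet> outward_normal v m)"
  using edge_length_bounds[OF polar_tetrahedron[OF assms(1)] labelling_distinct(6)[OF assms(2)]]
  by (auto simp: dihedral_angle_eq_polar_length[OF assms])

section \<open>The dihedral angle as a function of the opposite length\<close>

text \<open>For linearly independent unit vectors \<open>a\<close> and \<open>b\<close>, this is the component of \<open>z\<close> orthogonal to their span.\<close>

definition perp_part :: "'a :: real_inner \<Rightarrow> 'a \<Rightarrow> 'a \<Rightarrow> 'a" where
  "perp_part a b z =
     z - ((z \<bullet> a - (a \<bullet> b) * (z \<bullet> b)) / (1 - (a \<bullet> b)\<^sup>2)) *\<^sub>R a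
       - ((z \<bullet> b - (a \<bullet> b) * (z \<bullet> a)) / (1 - (a \<bullet> b)\<^sup>2)) *\<^sub>R b"

lemma perp_part_orthogonal:
  assumes "norm a = 1" "norm b = 1" "(a \<bullet> b)\<^sup>2 \<noteq> 1"
  shows "perp_part a b z \<bullet> a = 0" "perp_part a b z \<bullet> b = 0"
proof -
  have ab: "a \<bullet> a = 1" "b \<bullet> b = 1" "b \<bullet> a = a \<bullet> b"
    using assms by (auto simp: dot_square_norm inner_commute)
  have "1 - (a \<bullet> b)\<^sup>2 \<noteq> 0" using assms(3) by simp
  then show "perp_part a b z \<bullet> a = 0" "perp_part a b z \<bullet> b = 0"
    unfolding perp_part_def inner_diff_left inner_scaleR_left ab
    by (simp_all add: field_simps power2_eq_square)
qed

text \<open>The inner product of two such components depends on mutual inner products only, and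
  involves \<open>z \<bullet> z'\<close> just as a summand. This is what makes the dihedral angle a function of the
  edge lengths, with a simple dependence on the length of the opposite edge.\<close>

lemma perp_part_inner:
  assumes "norm a = 1" "norm b = 1" "(a \<bullet> b)\<^sup>2 \<noteq> 1"
  shows "perp_part a b z \<bullet> perp_part a b z' = z \<bullet> z' -
     ((z \<bullet> a - (a \<bullet> b) * (z \<bullet> b)) * (z' \<bullet> a) + (z \<bullet> b - (a \<bullet> b) * (z \<bullet> a)) * (z' \<bullet> b))
       / (1 - (a \<bullet> b)\<^sup>2)"
proof -
  have "perp_part a b z \<bullet> perp_part a b z' = perp_part a b z \<bullet> z'"
    by (subst (2) perp_part_def) (simp add: inner_diff_right perp_part_orthogonal[OF assms])
  also have "\<dots> = z \<bullet> z' -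
     ((z \<bullet> a - (a \<bullet> b) * (z \<bullet> b)) * (z' \<bullet> a) + (z \<bullet> b - (a \<bullet> b) * (z \<bullet> a)) * (z' \<bullet> b))
       / (1 - (a \<bullet> b)\<^sup>2)"
    by (simp add: perp_part_def inner_diff_left inner_commute[of a z'] inner_commute[of b z']
        add_divide_distrib)
  finally show ?thesis .
qed

lemma inner_perp_part_of_orthogonal:
  assumes "w \<bullet> a = 0" "w \<bullet> b = 0"
  shows "w \<bullet> perp_part a b z = w \<bullet> z"
  using assms by (simp add: perp_part_def inner_diff_right)

text \<open>Seen along the edge \<open>v i, v j\<close>, the tetrahedron is a planar sector: the components \<open>x\<close> and
  \<open>y\<close> of the other two vertices orthogonal to the edge include the dihedral angle, and the
  outward normals opposite \<open>v k\<close> and \<open>v m\<close> are unit vectors of the same plane, perpendicular to \<open>y\<close>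
  and \<open>x\<close> respectively.\<close>

lemma dihedral_sector:
  assumes v: "spherical_tetrahedron v" and lab: "{i, j, k, m} = UNIV"
  defines "x \<equiv> perp_part (v i) (v j) (v k)" and "y \<equiv> perp_part (v i) (v j) (v m)"
    and "\<theta> \<equiv> dihedral_angle v i j"
  shows "norm x > 0" "norm y > 0"
    and "cos \<theta> = (x \<bullet> y) / (norm x * norm y)"
    and "outward_normal v k \<bullet> v k = - (norm x * sin \<theta>)"
    and "outward_normal v m \<bullet> v m = - (norm y * sin \<theta>)"
proof -
  note d = labelling_distinct[OF lab]
  let ?w = "outward_normal v"
  have ij: "norm (v i) = 1" "norm (v j) = 1" "(v i \<bullet> v j)\<^sup>2 \<noteq> 1"
    using tetrahedron_norm[OF v] tetrahedron_inner_bounds(1)[OF v d(1)] by auto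
  note wo = outward_normal_orthogonal[OF v]
  have wx: "?w k \<bullet> x = ?w k \<bullet> v k" "?w m \<bullet> x = 0" and wy: "?w m \<bullet> y = ?w m \<bullet> v m" "?w k \<bullet> y = 0"
    using d by (auto simp: x_def y_def inner_perp_part_of_orthogonal wo)
  have neg: "?w k \<bullet> v k < 0" "?w m \<bullet> v m < 0" by (rule outward_normal_negative[OF v])+
  have "x \<noteq> 0" "y \<noteq> 0" using wx wy neg by auto
  then show pos: "norm x > 0" "norm y > 0" by auto
  define C where "C = (x \<bullet> y) / (norm x * norm y)"
  have xx: "x \<bullet> x = (norm x)\<^sup>2" "y \<bullet> y = (norm y)\<^sup>2" by (simp_all add: dot_square_norm)
  have xy: "x \<bullet> y = C * norm x * norm y" using pos by (simp add: C_def)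
  \<comment> \<open>The component of \<open>x\<close> normal to the ray of \<open>y\<close>, and conversely. They are negative multiples of
    the outward normals opposite \<open>v k\<close> and \<open>v m\<close>.\<close>
  define X where "X = x - (C * norm x / norm y) *\<^sub>R y"
  define Y where "Y = y - (C * norm y / norm x) *\<^sub>R x"
  have XX: "X \<bullet> X = (norm x)\<^sup>2 * (1 - C\<^sup>2)" and YY: "Y \<bullet> Y = (norm y)\<^sup>2 * (1 - C\<^sup>2)"
    using pos by (simp_all add: X_def Y_def inner_diff_left inner_diff_right xx xy
        inner_commute[of y x] field_simps power2_eq_square)
  have XY: "X \<bullet> Y = - C * norm x * norm y * (1 - C\<^sup>2)"
    using pos by (simp add: X_def Y_def inner_diff_left inner_diff_right xx xy
        inner_commute[of y x] field_simps power2_eq_square)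
  have "?w k \<bullet> X \<noteq> 0" using wx wy neg by (simp add: X_def inner_diff_right)
  then have "X \<bullet> X > 0" by auto
  then have C1: "1 - C\<^sup>2 > 0" using pos by (simp add: XX zero_less_mult_iff)
  define S where "S = sqrt (1 - C\<^sup>2)"
  have S: "S > 0" "S\<^sup>2 = 1 - C\<^sup>2" using C1 by (auto simp: S_def)
  have Xx: "X \<bullet> x = (norm x)\<^sup>2 * S\<^sup>2" "X \<bullet> y = 0"
    and Yy: "Y \<bullet> y = (norm y)\<^sup>2 * S\<^sup>2" "Y \<bullet> x = 0"
    unfolding S(2) using pos by (simp_all add: X_def Y_def inner_diff_left xx xy
        inner_commute[of y x] field_simps power2_eq_square)
  have nX: "norm X = norm x * S" and nY: "norm Y = norm y * S"
    by (simp_all add: norm_eq_sqrt_inner XX[unfolded norm_eq_sqrt_inner]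
        YY[unfolded norm_eq_sqrt_inner] real_sqrt_mult S_def)
  have o: "x \<bullet> v i = 0" "x \<bullet> v j = 0" "y \<bullet> v i = 0" "y \<bullet> v j = 0"
    by (simp_all add: x_def y_def perp_part_orthogonal[OF ij])
  have xv: "z \<bullet> v k = z \<bullet> x" "z \<bullet> v m = z \<bullet> y" if "z \<bullet> v i = 0" "z \<bullet> v j = 0" for z
    using that by (simp_all add: x_def y_def inner_perp_part_of_orthogonal)
  have wk: "?w k = - (X /\<^sub>R (norm x * S))"
  proof (rule outward_normal_eqI[OF v])
    show "norm (- (X /\<^sub>R (norm x * S))) = 1" using pos S(1) by (simp add: nX abs_mult field_simps)
    have Xo: "X \<bullet> v i = 0" "X \<bullet> v j = 0" by (simp_all add: X_def inner_diff_left o)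
    have "X \<bullet> v m = 0" by (simp add: xv[OF Xo] Xx)
    then show "- (X /\<^sub>R (norm x * S)) \<bullet> v q = 0" if "q \<noteq> k" for q
      using labelling_exhaust[OF lab, of q] that Xo by auto
    have "X \<bullet> v k = (norm x)\<^sup>2 * S\<^sup>2" by (simp add: xv[OF Xo] Xx)
    then show "- (X /\<^sub>R (norm x * S)) \<bullet> v k < 0" using pos S(1) by simp
  qed
  have wm: "?w m = - (Y /\<^sub>R (norm y * S))"
  proof (rule outward_normal_eqI[OF v])
    show "norm (- (Y /\<^sub>R (norm y * S))) = 1" using pos S(1) by (simp add: nY abs_mult field_simps)
    have Yo: "Y \<bullet> v i = 0" "Y \<bullet> v j = 0" by (simp_all add: Y_def inner_diff_left o)
    have "Y \<bullet> v k = 0" by (simp add: xv[OF Yo] Yy)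
    then show "- (Y /\<^sub>R (norm y * S)) \<bullet> v q = 0" if "q \<noteq> m" for q
      using labelling_exhaust[OF lab, of q] that Yo by auto
    have "Y \<bullet> v m = (norm y)\<^sup>2 * S\<^sup>2" by (simp add: xv[OF Yo] Yy)
    then show "- (Y /\<^sub>R (norm y * S)) \<bullet> v m < 0" using pos S(1) by simp
  qed
  have "cos \<theta> = - (?w k \<bullet> ?w m)"
    unfolding \<theta>_def by (rule dihedral_angle_bounds[OF v lab])
  also have "\<dots> = C * S\<^sup>2 / (S * S)"
    using pos S(1) by (simp add: wk wm XY S(2)[symmetric] field_simps)
  also have "\<dots> = C" using S(1) by (simp add: power2_eq_square)
  finally show cos: "cos \<theta> = (x \<bullet> y) / (norm x * norm y)" by (simp add: C_def)
  then have "sin \<theta> = S"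
    using dihedral_angle_bounds(1,2)[OF v lab] unfolding \<theta>_def[symmetric]
    by (subst sin_cos_sqrt) (auto simp: S_def C_def cos intro: sin_ge_zero)
  moreover have "?w k \<bullet> v k = - (norm x * S)"
  proof -
    have "?w k \<bullet> v k = ?w k \<bullet> x" by (simp add: wx)
    also have "\<dots> = - ((norm x)\<^sup>2 * S\<^sup>2 / (norm x * S))"
      unfolding wk by (simp add: Xx divide_inverse mult.commute)
    finally show ?thesis using pos S(1) by (simp add: power2_eq_square)
  qed
  moreover have "?w m \<bullet> v m = - (norm y * S)"
  proof -
    have "?w m \<bullet> v m = ?w m \<bullet> y" by (simp add: wy)
    also have "\<dots> = - ((norm y)\<^sup>2 * S\<^sup>2 / (norm y * S))"
      unfolding wm by (simp add: Yy divide_inverse mult.commute)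
    finally show ?thesis using pos S(1) by (simp add: power2_eq_square)
  qed
  ultimately show "?w k \<bullet> v k = - (norm x * sin \<theta>)" "?w m \<bullet> v m = - (norm y * sin \<theta>)" by auto
qed

text \<open>Any angle in \<open>(0, \<pi>)\<close> can be achieved by rotating the vertex \<open>v m\<close> about the edge
  \<open>v i, v j\<close>. The only length that changes is that of the opposite edge.\<close>

lemma rotated_tetrahedron:
  assumes v: "spherical_tetrahedron v" and lab: "{i, j, k, m} = UNIV" and \<tau>: "0 < \<tau>" "\<tau> < pi"
  defines "x \<equiv> perp_part (v i) (v j) (v k)" and "y \<equiv> perp_part (v i) (v j) (v m)"
  obtains u where "spherical_tetrahedron (v(m := u))"
    "u \<bullet> v i = v m \<bullet> v i" "u \<bullet> v j = v m \<bullet> v j"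
    "u \<bullet> v k = v m \<bullet> v k - x \<bullet> y + norm x * norm y * cos \<tau>"
proof -
  note d = labelling_distinct[OF lab]
  let ?w = "outward_normal v m"
  have ij: "norm (v i) = 1" "norm (v j) = 1" "(v i \<bullet> v j)\<^sup>2 \<noteq> 1"
    using tetrahedron_norm[OF v] tetrahedron_inner_bounds(1)[OF v d(1)] by auto
  have pos: "norm x > 0" "norm y > 0"
    unfolding x_def y_def by (rule dihedral_sector[OF v lab])+
  have wo: "?w \<bullet> v i = 0" "?w \<bullet> v j = 0" "?w \<bullet> v k = 0"
    using d by (auto intro: outward_normal_orthogonal[OF v])
  have ww: "?w \<bullet> ?w = 1" by (simp add: dot_square_norm norm_outward_normal[OF v])
  have o: "x \<bullet> v i = 0" "x \<bullet> v j = 0" "y \<bullet> v i = 0" "y \<bullet> v j = 0"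
    by (simp_all add: x_def y_def perp_part_orthogonal[OF ij])
  have wx: "?w \<bullet> x = 0" and wy: "?w \<bullet> y = ?w \<bullet> v m"
    by (simp_all add: x_def y_def inner_perp_part_of_orthogonal wo)
  have xk: "x \<bullet> v k = (norm x)\<^sup>2" and yk: "y \<bullet> v k = x \<bullet> y"
    and ym: "y \<bullet> v m = (norm y)\<^sup>2" and xm: "x \<bullet> v m = x \<bullet> y"
    using inner_perp_part_of_orthogonal[OF o(1,2), of "v k"]
      inner_perp_part_of_orthogonal[OF o(3,4), of "v k"]
      inner_perp_part_of_orthogonal[OF o(3,4), of "v m"]
      inner_perp_part_of_orthogonal[OF o(1,2), of "v m"]
    by (simp_all add: x_def[symmetric] y_def[symmetric] dot_square_norm inner_commute)
  \<comment> \<open>In the plane orthogonal to the edge, \<open>x\<close> and \<open>- ?w\<close> give orthogonal axes.\<close>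
  define e where "e = x /\<^sub>R norm x"
  have ee: "e \<bullet> e = 1" using pos by (simp add: e_def dot_square_norm power2_eq_square)
  \<comment> \<open>\<open>v m - y\<close> is the component along the edge, and a vector of length \<open>norm y\<close> at angle \<open>\<tau>\<close> to \<open>x\<close>
    replaces \<open>y\<close>. The sign of the second axis puts \<open>v m\<close> and \<open>u\<close> on the same side of the face
    \<open>v i, v j, v k\<close>.\<close>
  define u where "u = (v m - y) + norm y *\<^sub>R (cos \<tau> *\<^sub>R e - sin \<tau> *\<^sub>R ?w)"
  have eo: "e \<bullet> v i = 0" "e \<bullet> v j = 0" "e \<bullet> v k = norm x" "e \<bullet> ?w = 0"
    "e \<bullet> (v m - y) = 0"
    using pos wx by (simp_all add: e_def o xk xm inner_diff_right power2_eq_square inner_commute)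
  have ui: "u \<bullet> v i = v m \<bullet> v i" and uj: "u \<bullet> v j = v m \<bullet> v j"
    by (simp_all add: u_def inner_add_left inner_diff_left eo o wo)
  have uk: "u \<bullet> v k = v m \<bullet> v k - x \<bullet> y + norm x * norm y * cos \<tau>"
    by (simp add: u_def inner_add_left inner_diff_left eo yk wo)
  have wu: "u \<bullet> ?w < 0"
  proof -
    have "u \<bullet> ?w = - (norm y * sin \<tau>)"
      using wy[unfolded inner_commute[of ?w]]
      by (simp add: u_def inner_add_left inner_diff_left eo ww)
    then show ?thesis using pos sin_gt_zero[OF \<tau>] by simp
  qed
  have "norm u = 1"
  proof -
    let ?r = "cos \<tau> *\<^sub>R e - sin \<tau> *\<^sub>R ?w"
    have "?r \<bullet> ?r = (cos \<tau>)\<^sup>2 + (sin \<tau>)\<^sup>2"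
      by (simp add: inner_diff_left inner_diff_right ee ww eo inner_commute[of ?w e]
          power2_eq_square)
    then have rr: "?r \<bullet> ?r = 1" by simp
    have "(v m - y) \<bullet> ?w = 0"
      using wy[unfolded inner_commute[of ?w]] by (simp add: inner_diff_left)
    then have "(v m - y) \<bullet> ?r = 0"
      using eo(5)[unfolded inner_commute[of e]]
      by (simp add: inner_diff_right)
    moreover have "(v m - y) \<bullet> (v m - y) = 1 - (norm y)\<^sup>2"
      using ym tetrahedron_inner_self[OF v, of m]
      by (simp add: inner_diff_left inner_diff_right inner_commute[of "v m" y]) 
        (simp add: dot_square_norm)
    ultimately have "u \<bullet> u = 1"
      unfolding u_def using rr
      by (simp add: inner_add_left[of "v m - y"] inner_add_right[of _ "v m - y"]
          inner_commute[of ?r "v m - y"] power2_eq_square)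
    then show ?thesis by (simp add: norm_eq_sqrt_inner)
  qed
  moreover have nspan: "u \<notin> span (v ` {i, j, k})"
  proof
    assume "u \<in> span (v ` {i, j, k})"
    then have "orthogonal ?w u"
      by (rule orthogonal_to_span) (auto simp: orthogonal_def wo)
    then show False using wu by (simp add: orthogonal_def inner_commute)
  qed
  moreover have "range (v(m := u)) = insert u (v ` {i, j, k})"
  proof -
    have "range (v(m := u)) = v(m := u) ` {i, j, k, m}" using lab by simp
    then show ?thesis using d by auto
  qed
  moreover have "independent (v ` {i, j, k})"
    using v independent_mono[of "range v"] by (auto simp: spherical_tetrahedron_def image_mono)
  moreover have "inj (v(m := u))"
  proof -
    have "inj_on v (UNIV - {m})"
      using v unfolding spherical_tetrahedron_def by (blast intro: inj_on_subset[of v UNIV])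
    moreover have "u \<notin> v ` (UNIV - {m})"
    proof -
      have "UNIV - {m} = {i, j, k}" using lab d by auto
      then show ?thesis using nspan by (auto intro: span_base)
    qed
    ultimately have "inj_on (v(m := u)) (insert m (UNIV - {m}))"
      unfolding inj_on_insert by (auto simp: inj_on_def)
    moreover have "insert m (UNIV - {m}) = UNIV" by auto
    ultimately show ?thesis by simp
  qed
  ultimately have "spherical_tetrahedron (v(m := u))"
    using tetrahedron_norm[OF v] by (auto simp: spherical_tetrahedron_def independent_insert)
  then show ?thesis using that ui uj uk by blast
qed

lemma edge_lengths_determine_inner:
  assumes "spherical_tetrahedron v" "spherical_tetrahedron v'" "p \<noteq> q"
    and "edge_length v' p q = edge_length v p q"
  shows "v' p \<bullet> v' q = v p \<bullet> v q"
  using edge_length_bounds(3)[OF assms(1,3)] edge_length_bounds(3)[OF assms(2,3)] assms(4) by simp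

text \<open>The values that the angle at \<open>v i, v j\<close> can take when the length of the opposite edge is
  changed to \<open>t\<close>. Keeping the relation, and not only the value that \<open>angle_of_lengths\<close> selects
  from it, allows it to be transported to the polar tetrahedron.\<close>

definition realizable_angle :: "(4 \<Rightarrow> real ^ 4) \<Rightarrow> 4 \<Rightarrow> 4 \<Rightarrow> 4 \<Rightarrow> 4 \<Rightarrow> real \<Rightarrow> real \<Rightarrow> bool" where
  "realizable_angle v i j k m t \<theta> \<longleftrightarrow> (\<exists>v'. spherical_tetrahedron v' \<and>
     (\<forall>p q. p \<noteq> q \<longrightarrow> edge_length v' p q = edge_upd (edge_length v) k m t p q) \<and>
     dihedral_angle v' i j = \<theta>)"

text \<open>The spherical law of cosines for the edge \<open>v i, v j\<close>, solved for the angle. Uniqueness holds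
  because \<open>norm x\<close>, \<open>norm y\<close> and \<open>v k \<bullet> v m - x \<bullet> y\<close> are determined by the five lengths that are
  kept; existence is by rotation about the edge.\<close>

lemma realizable_angle_iff:
  assumes v: "spherical_tetrahedron v" and lab: "{i, j, k, m} = UNIV"
  defines "x \<equiv> perp_part (v i) (v j) (v k)" and "y \<equiv> perp_part (v i) (v j) (v m)"
  assumes t: "0 < t" "t < pi" and
    c: "\<bar>(cos t - (v k \<bullet> v m - x \<bullet> y)) / (norm x * norm y)\<bar> < 1" (is "\<bar>?c\<bar> < 1")
  shows "realizable_angle v i j k m t \<theta> \<longleftrightarrow> \<theta> = arccos ?c"
proof -
  note d = labelling_distinct[OF lab]
  have pos: "norm x > 0" "norm y > 0"
    unfolding x_def y_def by (rule dihedral_sector[OF v lab])+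
  let ?P = "\<lambda>v'. spherical_tetrahedron v' \<and>
    (\<forall>p q. p \<noteq> q \<longrightarrow> edge_length v' p q = edge_upd (edge_length v) k m t p q)"
  have angle: "dihedral_angle v' i j = arccos ?c" if v': "?P v'" for v'
  proof -
    have tv': "spherical_tetrahedron v'" using v' by blast
    have same: "v' p \<bullet> v' q = v p \<bullet> v q" if "{p, q} \<noteq> {k, m}" for p q
    proof (cases "p = q")
      case True
      then show ?thesis by (simp add: tetrahedron_inner_self v tv')
    next
      case False
      then show ?thesis using v' that
        by (intro edge_lengths_determine_inner v tv') (auto simp: edge_upd_def)
    qed
    have km: "v' k \<bullet> v' m = cos t"
      using v' edge_length_bounds(3)[OF tv' d(6)] d(6) by (auto simp: edge_upd_def)
    define x' where "x' = perp_part (v' i) (v' j) (v' k)"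
    define y' where "y' = perp_part (v' i) (v' j) (v' m)"
    have ij: "norm (v i) = 1" "norm (v j) = 1" "(v i \<bullet> v j)\<^sup>2 \<noteq> 1"
      using tetrahedron_norm[OF v] tetrahedron_inner_bounds(1)[OF v d(1)] by auto
    have ij': "norm (v' i) = 1" "norm (v' j) = 1" "(v' i \<bullet> v' j)\<^sup>2 \<noteq> 1"
      using tetrahedron_norm[OF tv'] tetrahedron_inner_bounds(1)[OF tv' d(1)] by auto
    have ne: "{i, j} \<noteq> {k, m}" "{k, i} \<noteq> {k, m}" "{k, j} \<noteq> {k, m}" "{m, i} \<noteq> {k, m}"
      "{m, j} \<noteq> {k, m}" "{k, k} \<noteq> {k, m}" "{m, m} \<noteq> {k, m}"
      using d by (auto simp: doubleton_eq_iff)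
    note same = ne[THEN same]
    have "x' \<bullet> x' = x \<bullet> x" "y' \<bullet> y' = y \<bullet> y"
      unfolding x_def y_def x'_def y'_def perp_part_inner[OF ij] perp_part_inner[OF ij'] same
      by simp_all
    then have n: "norm x' = norm x" "norm y' = norm y" by (simp_all add: norm_eq_sqrt_inner)
    have "x' \<bullet> y' - cos t = x \<bullet> y - v k \<bullet> v m"
      unfolding x_def y_def x'_def y'_def perp_part_inner[OF ij] perp_part_inner[OF ij'] same km
      by simp
    then have "cos (dihedral_angle v' i j) = ?c"
      using dihedral_sector(3)[OF tv' lab] n by (simp add: x'_def[symmetric] y'_def[symmetric])
    then show ?thesis
      using dihedral_angle_bounds(1,2)[OF tv' lab] arccos_cos[of "dihedral_angle v' i j"]
      by simp
  qed
  \<comment> \<open>Rotate \<open>v m\<close> about the edge to the angle that the law of cosines predicts.\<close>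
  have ex: "\<exists>v'. ?P v'"
  proof -
    have c': "-1 < ?c" "?c < 1" using c unfolding abs_less_iff by linarith+
    obtain u where u: "spherical_tetrahedron (v(m := u))"
      "u \<bullet> v i = v m \<bullet> v i" "u \<bullet> v j = v m \<bullet> v j"
      "u \<bullet> v k = v m \<bullet> v k - x \<bullet> y + norm x * norm y * cos (arccos ?c)"
      using rotated_tetrahedron[OF v lab, of "arccos ?c"] arccos_lt_bounded[OF c']
      unfolding x_def y_def by blast
    have "cos (arccos ?c) = ?c" using c' by (intro cos_arccos) auto
    then have uk: "u \<bullet> v k = cos t" using u(4) pos by (simp add: inner_commute[of "v m"])
    let ?v' = "v(m := u)"
    have "edge_length ?v' p q = edge_upd (edge_length v) k m t p q" if "p \<noteq> q" for p q
    proof -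
      have um: "edge_length ?v' m q = edge_upd (edge_length v) k m t m q" if "m \<noteq> q" for q
      proof -
        consider "q = i" | "q = j" | "q = k" using labelling_exhaust[OF lab, of q] \<open>m \<noteq> q\<close> by metis
        then show ?thesis
          using d u uk t by cases (auto simp: edge_length_def edge_upd_def doubleton_eq_iff arccos_cos)
      qed
      consider "p = m" | "q = m" | "p \<noteq> m" "q \<noteq> m" by blast
      then show ?thesis
      proof cases
        case 1
        then show ?thesis using um that by auto
      next
        case 2
        have "edge_length ?v' p q = edge_length ?v' q p"
          "edge_upd (edge_length v) k m t p q = edge_upd (edge_length v) k m t q p"
          by (auto simp: edge_length_def edge_upd_def inner_commute insert_commute)
        then show ?thesis using um[of p] that 2 by auto
      next
        case 3
        then show ?thesis by (auto simp: edge_length_def edge_upd_def doubleton_eq_iff)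
      qed
    qed
    then show ?thesis using u(1) by blast
  qed
  show ?thesis
  proof
    assume "realizable_angle v i j k m t \<theta>"
    then obtain v' where "?P v'" and \<theta>: "dihedral_angle v' i j = \<theta>"
      unfolding realizable_angle_def by (elim exE conjE) (rule that, intro conjI)
    from angle[OF this(1)] \<theta> show "\<theta> = arccos ?c" by simp
  next
    assume \<theta>: "\<theta> = arccos ?c"
    from ex obtain v' where P: "?P v'" ..
    have "dihedral_angle v' i j = \<theta>" unfolding \<theta> by (rule angle[OF P])
    with P show "realizable_angle v i j k m t \<theta>"
      unfolding realizable_angle_def by (intro exI[of _ v'] conjI) (elim conjE, assumption)+
  qed
qed

text \<open>Differentiating \<open>cos l' = const + norm x * norm y * cos \<theta>\<close> gives
  \<open>sin l' / (norm x * norm y * sin \<theta>)\<close>. In the form below, the value is visibly unchanged when the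
  tetrahedron is replaced by its polar: the two sines are exchanged, and the denominator is
  symmetric in vertices and normals.\<close>

lemma realizable_angle_derivative:
  assumes v: "spherical_tetrahedron v" and lab: "{i, j, k, m} = UNIV"
  shows "\<exists>S F. open S \<and> edge_length v k m \<in> S \<and>
    (\<forall>t\<in>S. \<forall>\<theta>. realizable_angle v i j k m t \<theta> \<longleftrightarrow> \<theta> = F t) \<and>
    (F has_real_derivative sin (edge_length v k m) * sin (dihedral_angle v i j) /
        ((outward_normal v k \<bullet> v k) * (outward_normal v m \<bullet> v m))) (at (edge_length v k m))"
proof -
  note d = labelling_distinct[OF lab]
  define x where "x = perp_part (v i) (v j) (v k)"
  define y where "y = perp_part (v i) (v j) (v m)"
  define \<theta> where "\<theta> = dihedral_angle v i j"
  define l where "l = edge_length v k m"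
  note sector = dihedral_sector[OF v lab, folded x_def y_def \<theta>_def]
  define R where "R = norm x * norm y"
  have R: "R > 0" using sector by (simp add: R_def)
  define A where "A = v k \<bullet> v m - x \<bullet> y"
  define c where "c t = (cos t - A) / R" for t
  have l: "0 < l" "l < pi" "cos l = v k \<bullet> v m"
    unfolding l_def using edge_length_bounds[OF v d(6)] by auto
  have \<theta>: "0 < \<theta>" "\<theta> < pi" unfolding \<theta>_def using dihedral_angle_bounds[OF v lab] by auto
  have cl: "c l = cos \<theta>" using sector(3) by (simp add: c_def A_def l R_def)
  have s: "sin \<theta> > 0" by (rule sin_gt_zero[OF \<theta>])
  have c1: "-1 < c l" "c l < 1"
    using \<theta> cos_monotone_0_pi[of 0 \<theta>] cos_monotone_0_pi[of \<theta> pi] by (auto simp: cl)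
  have "sqrt (1 - (c l)\<^sup>2) = sin \<theta>"
    unfolding cl using \<theta> by (intro sin_cos_sqrt[symmetric] sin_ge_zero) auto
  moreover have "(c has_real_derivative - sin l / R) (at l)"
    unfolding c_def using R by (auto intro!: derivative_eq_intros)
  ultimately have "((\<lambda>t. arccos (c t)) has_real_derivative inverse (- sin \<theta>) * (- sin l / R)) (at l)"
    using DERIV_chain2[of arccos _ c l, OF DERIV_arccos[OF c1]] by metis
  also have "inverse (- sin \<theta>) * (- sin l / R) = sin l * sin \<theta> /
      ((outward_normal v k \<bullet> v k) * (outward_normal v m \<bullet> v m))"
    unfolding sector(4,5) R_def
    using s sector(1,2) by (simp add: field_simps)
  finally have deriv: "((\<lambda>t. arccos (c t)) has_real_derivative sin l * sin \<theta> /
      ((outward_normal v k \<bullet> v k) * (outward_normal v m \<bullet> v m))) (at l)" .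
  show ?thesis
    unfolding l_def[symmetric] \<theta>_def[symmetric]
  proof (rule exI[of _ "{t. 0 < t \<and> t < pi \<and> \<bar>c t\<bar> < 1}"],
      rule exI[of _ "\<lambda>t. arccos (c t)"], intro conjI ballI allI)
    show "open {t. 0 < t \<and> t < pi \<and> \<bar>c t\<bar> < 1}"
      unfolding c_def using R
      by (intro open_Collect_conj open_Collect_less) (auto intro!: continuous_intros)
    show "l \<in> {t. 0 < t \<and> t < pi \<and> \<bar>c t\<bar> < 1}" using l c1 by auto
    show "realizable_angle v i j k m t \<phi> \<longleftrightarrow> \<phi> = arccos (c t)"
      if "t \<in> {t. 0 < t \<and> t < pi \<and> \<bar>c t\<bar> < 1}" for t \<phi>
      using that unfolding c_def A_def R_def mem_Collect_eq
      by (elim conjE) (rule realizable_angle_iff[OF v lab, folded x_def y_def])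
  qed (rule deriv)
qed

section \<open>Polarity exchanges the two Wigner derivatives\<close>

text \<open>Prescribing dihedral angles that differ from those of \<open>v\<close> at one edge is prescribing lengths of
  the polar that differ from the polar lengths of \<open>v\<close> at the opposite edge.\<close>

lemma dihedral_angles_iff_polar_lengths:
  assumes v: "spherical_tetrahedron v" and lab: "{i, j, k, m} = UNIV"
    and v': "spherical_tetrahedron v'"
  shows "(\<forall>p q. p \<noteq> q \<longrightarrow> dihedral_angle v' p q = edge_upd (dihedral_angle v) i j s p q) \<longleftrightarrow>
    (\<forall>p q. p \<noteq> q \<longrightarrow> edge_length (outward_normal v') p q =
      edge_upd (edge_length (outward_normal v)) k m (pi - s) p q)"
proof -
  have pair: "dihedral_angle v' p q = edge_upd (dihedral_angle v) i j s p q \<longleftrightarrow>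
      edge_length (outward_normal v') r t =
        edge_upd (edge_length (outward_normal v)) k m (pi - s) r t"
    if "{p, q, r, t} = UNIV" for p q r t
  proof -
    have "{r, t} = UNIV - {p, q}" "{p, q} = UNIV - {r, t}"
      using labelling_distinct[OF that] that by auto
    moreover have "{k, m} = UNIV - {i, j}" "{i, j} = UNIV - {k, m}"
      using labelling_distinct[OF lab] lab by auto
    ultimately have "{p, q} = {i, j} \<longleftrightarrow> {r, t} = {k, m}" by metis
    then show ?thesis
      using dihedral_angle_eq_polar_length[OF v that] dihedral_angle_eq_polar_length[OF v' that]
      by (auto simp: edge_upd_def)
  qed
  show ?thesis
  proof (intro iffI allI impI)
    fix p q :: 4
    assume *: "\<forall>p q. p \<noteq> q \<longrightarrow> dihedral_angle v' p q = edge_upd (dihedral_angle v) i j s p q"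
      and "p \<noteq> q"
    obtain r t where rt: "{p, q, r, t} = UNIV" using \<open>p \<noteq> q\<close> by (rule labelling_complete)
    then have "{r, t, p, q} = UNIV" by auto
    from pair[OF this] * labelling_distinct(6)[OF rt]
    show "edge_length (outward_normal v') p q =
        edge_upd (edge_length (outward_normal v)) k m (pi - s) p q" by blast
  next
    fix p q :: 4
    assume *: "\<forall>p q. p \<noteq> q \<longrightarrow> edge_length (outward_normal v') p q =
        edge_upd (edge_length (outward_normal v)) k m (pi - s) p q"
      and "p \<noteq> q"
    obtain r t where rt: "{p, q, r, t} = UNIV" using \<open>p \<noteq> q\<close> by (rule labelling_complete)
    from pair[OF this] * labelling_distinct(6)[OF rt]
    show "dihedral_angle v' p q = edge_upd (dihedral_angle v) i j s p q" by blast
  qed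
qed

text \<open>The tetrahedra on the two sides are each other's polars.\<close>

lemma realizable_length_iff_polar_angle:
  assumes v: "spherical_tetrahedron v" and lab: "{i, j, k, m} = UNIV"
  shows "(\<exists>v'. spherical_tetrahedron v' \<and>
      (\<forall>p q. p \<noteq> q \<longrightarrow> dihedral_angle v' p q = edge_upd (dihedral_angle v) i j s p q) \<and>
      edge_length v' k m = l) \<longleftrightarrow>
    realizable_angle (outward_normal v) i j k m (pi - s) (pi - l)" (is "?L \<longleftrightarrow> ?R")
proof
  assume ?L
  then obtain v' where v': "spherical_tetrahedron v'"
    "\<forall>p q. p \<noteq> q \<longrightarrow> dihedral_angle v' p q = edge_upd (dihedral_angle v) i j s p q"
    "edge_length v' k m = l" by blast
  then have "dihedral_angle (outward_normal v') i j = pi - l"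
    using edge_length_eq_polar_angle[OF v'(1) lab] by simp
  then show ?R
    unfolding realizable_angle_def
    using v'(2) polar_tetrahedron[OF v'(1)]
    unfolding dihedral_angles_iff_polar_lengths[OF v lab v'(1)] by blast
next
  assume ?R
  then obtain w where w: "spherical_tetrahedron w"
    "\<forall>p q. p \<noteq> q \<longrightarrow> edge_length w p q = edge_upd (edge_length (outward_normal v)) k m (pi - s) p q"
    "dihedral_angle w i j = pi - l" unfolding realizable_angle_def by blast
  define v' where "v' = outward_normal w"
  have v': "spherical_tetrahedron v'" "outward_normal v' = w"
    using polar_tetrahedron[OF w(1)] polar_polar[OF w(1)] by (simp_all add: v'_def)
  have "edge_length v' k m = l"
    using edge_length_eq_polar_angle[OF v'(1) lab] w(3) v'(2) by simp
  moreover have "\<forall>p q. p \<noteq> q \<longrightarrow> dihedral_angle v' p q = edge_upd (dihedral_angle v) i j s p q"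
    unfolding dihedral_angles_iff_polar_lengths[OF v lab v'(1)] v'(2) by (rule w(2))
  ultimately show ?L using v'(1) by blast
qed

lemma angle_of_lengths_eq_realizable:
  "angle_of_lengths i j (edge_upd (edge_length v) k m t) = (THE \<theta>. realizable_angle v i j k m t \<theta>)"
  by (simp only: angle_of_lengths_def realizable_angle_def)

lemma wigner_derivative:
  assumes v: "spherical_tetrahedron v" and lab: "{i, j, k, m} = UNIV"
  shows "((\<lambda>t. angle_of_lengths i j (edge_upd (edge_length v) k m t)) has_real_derivative
      sin (edge_length v k m) * sin (dihedral_angle v i j) /
        ((outward_normal v k \<bullet> v k) * (outward_normal v m \<bullet> v m))) (at (edge_length v k m))"
proof -
  obtain S F where SF: "open S \<and> edge_length v k m \<in> S \<and>
    (\<forall>t\<in>S. \<forall>\<theta>. realizable_angle v i j k m t \<theta> \<longleftrightarrow> \<theta> = F t) \<and>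
    (F has_real_derivative sin (edge_length v k m) * sin (dihedral_angle v i j) /
        ((outward_normal v k \<bullet> v k) * (outward_normal v m \<bullet> v m))) (at (edge_length v k m))"
    using realizable_angle_derivative[OF assms] by (elim exE) (rule that)
  have S: "open S" "edge_length v k m \<in> S"
    by (rule SF[THEN conjunct1], rule SF[THEN conjunct2, THEN conjunct1])
  have F: "realizable_angle v i j k m t \<theta> \<longleftrightarrow> \<theta> = F t" if "t \<in> S" for t \<theta>
    by (rule SF[THEN conjunct2, THEN conjunct2, THEN conjunct1, rule_format, OF that])
  note deriv = SF[THEN conjunct2, THEN conjunct2, THEN conjunct2]
  show ?thesis
  proof (rule has_field_derivative_transform_within_open[OF deriv S])
    show "F t = angle_of_lengths i j (edge_upd (edge_length v) k m t)" if "t \<in> S" for t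
      unfolding angle_of_lengths_eq_realizable F[OF that] by simp
  qed
qed

text \<open>Near the given tetrahedron, the length is \<open>\<pi> - F (\<pi> - s)\<close>, where \<open>F\<close> is the angle of the
  polar tetrahedron as a function of its opposite length. The two changes of sign cancel in the
  derivative, so it is the value of \<open>wigner_derivative\<close> at the polar.\<close>

lemma inverse_wigner_derivative:
  assumes v: "spherical_tetrahedron v" and lab: "{i, j, k, m} = UNIV"
  shows "((\<lambda>s. length_of_angles k m (edge_upd (dihedral_angle v) i j s)) has_real_derivative
      sin (edge_length v k m) * sin (dihedral_angle v i j) /
        ((outward_normal v k \<bullet> v k) * (outward_normal v m \<bullet> v m))) (at (dihedral_angle v i j))"
    (is "(_ has_real_derivative ?D) (at ?\<theta>)")
proof -
  let ?w = "outward_normal v"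
  have w: "spherical_tetrahedron ?w" by (rule polar_tetrahedron[OF v])
  have len: "edge_length ?w k m = pi - ?\<theta>"
    using dihedral_angle_eq_polar_length[OF v lab] by simp
  have ang: "dihedral_angle ?w i j = pi - edge_length v k m"
    using edge_length_eq_polar_angle[OF v lab] by simp
  obtain S F where SF: "open S \<and> pi - ?\<theta> \<in> S \<and>
    (\<forall>t\<in>S. \<forall>\<phi>. realizable_angle ?w i j k m t \<phi> \<longleftrightarrow> \<phi> = F t) \<and>
    (F has_real_derivative sin (pi - ?\<theta>) * sin (pi - edge_length v k m) /
        ((v k \<bullet> ?w k) * (v m \<bullet> ?w m))) (at (pi - ?\<theta>))"
    using realizable_angle_derivative[OF w lab] unfolding len ang polar_polar[OF v]
    by (elim exE) (rule that)
  have S: "open S" "pi - ?\<theta> \<in> S"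
    by (rule SF[THEN conjunct1], rule SF[THEN conjunct2, THEN conjunct1])
  have F: "realizable_angle ?w i j k m t \<phi> \<longleftrightarrow> \<phi> = F t" if "t \<in> S" for t \<phi>
    by (rule SF[THEN conjunct2, THEN conjunct2, THEN conjunct1, rule_format, OF that])
  note deriv = SF[THEN conjunct2, THEN conjunct2, THEN conjunct2]
  have D: "sin (pi - ?\<theta>) * sin (pi - edge_length v k m) / ((v k \<bullet> ?w k) * (v m \<bullet> ?w m)) = ?D"
    by (simp add: inner_commute mult.commute)
  have "((\<lambda>s. F (pi - s)) has_real_derivative ?D * (- 1)) (at ?\<theta>)"
    by (rule DERIV_chain2[of F _ "\<lambda>s. pi - s", OF deriv[unfolded D]])
      (auto intro!: derivative_eq_intros)
  then have deriv': "((\<lambda>s. pi - F (pi - s)) has_real_derivative ?D) (at ?\<theta>)"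
    by (auto intro!: derivative_eq_intros)
  have "open ((\<lambda>s. pi - s) -` S)"
    by (rule open_vimage[OF S(1)]) (intro continuous_intros)
  then show ?thesis
  proof (rule has_field_derivative_transform_within_open[OF deriv'])
    show "?\<theta> \<in> (\<lambda>s. pi - s) -` S" using S(2) by simp
    show "pi - F (pi - s) = length_of_angles k m (edge_upd (dihedral_angle v) i j s)"
      if "s \<in> (\<lambda>s. pi - s) -` S" for s
    proof -
      have "pi - s \<in> S" using that by simp
      then have "realizable_angle ?w i j k m (pi - s) (pi - l) \<longleftrightarrow> l = pi - F (pi - s)" for l
        using F by auto
      then show ?thesis
        unfolding length_of_angles_def realizable_length_iff_polar_angle[OF v lab] by simp
    qed
  qed
qed

theorem corollary1p3:
  fixes v :: "4 \<Rightarrow> real ^ 4" and i j k m :: 4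
  assumes "spherical_tetrahedron v"
    and "{i, j, k, m} = {0, 1, 2, 3}"
  defines "\<Theta> \<equiv> \<lambda>t. angle_of_lengths i j (edge_upd (edge_length v) k m t)"
    and "L \<equiv> \<lambda>s. length_of_angles k m (edge_upd (dihedral_angle v) i j s)"
  shows "\<Theta> field_differentiable (at (edge_length v k m)) \<and>
         L field_differentiable (at (dihedral_angle v i j)) \<and>
         deriv \<Theta> (edge_length v k m) = deriv L (dihedral_angle v i j)"
proof -
  have lab: "{i, j, k, m} = UNIV" using assms(2) by (simp only: zero_to_three_eq_UNIV)
  note derivs = wigner_derivative[OF assms(1) lab, folded \<Theta>_def]
    inverse_wigner_derivative[OF assms(1) lab, folded L_def]
  then show ?thesis
    using derivs[THEN DERIV_imp_deriv] by (auto simp: field_differentiable_def)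
qed

end
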